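(* The following characterizations of the spectra hold: 1. $\sigma(\mathbf{D},\mathcal{H}_{+,0})=\{-\log n: n\in\mathbb{N},\ n\ge2\}$; 2. $\sigma(\mathbf{D},\mathcal{H}_{+})=\{0\}\cup\{-\log n: n\in\mathbb{N},\ n\ge2\}$; 3. $\sigma(\mathbf{J},\mathcal{H}_{+,0})=\{-\frac{1}{\log n}: n\in\mathbb{N},\ n\ge2\}$.
   Context: $\mathcal{H}_{+}$ is the space of Dirichlet series $D=\sum a_nn^{-s}$ such that $\|D\|_{2,k}:=\big(\sum_n|a_n|^2n^{-2/k}\big)^{1/2}<\infty$ for every $k\in\mathbb{N}$, with the Fréchet topology given by these seminorms, and $\mathcal{H}_{+,0}$ is its closed subspace of series with $a_1=0$. The differentiation operator is $\mathbf{D}\big(\sum_{n\ge1}a_nn^{-s}\big)=-\sum_{n\ge2}a_n\log(n)\,n^{-s}$, acting on $\mathcal{H}_+$ or on $\mathcal{H}_{+,0}$; the integration operator on $\mathcal{H}_{+,0}$ is $\mathbf{J}\big(\sum_{n\ge2}a_nn^{-s}\big)=-\sum_{n\ge2}\frac{a_n}{\log n}n^{-s}$. For a linear operator $T:X\to X$ on a Fréchet space, $\rho(T,X)$ is the set of $\lambda\in\mathbb{C}$ such that $\lambda I-T$ is bijective with continuous inverse, and $\sigma(T,X)=\mathbb{C}\setminus\rho(T,X)$. *)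

theory Defs
  imports "HOL-Analysis.Analysis" "HOL-Library.Function_Algebras"
begin

text \<open>The coarsest topology on \<open>X\<close> whose open sets include all balls of the seminorms in \<open>P\<close>.\<close>

definition seminorm_topology ::
    "('a::ab_group_add) set \<Rightarrow> ('a \<Rightarrow> real) set \<Rightarrow> 'a topology" where
  "seminorm_topology X P =
     topology_generated_by {{y \<in> X. p (y - x) < e} | x p e. x \<in> X \<and> p \<in> P \<and> 0 < e}"

text \<open>The space on which \<open>T\<close> acts is \<open>topspace X\<close>, a linear subspace of the type \<open>'a\<close> with
  scalar multiplication \<open>smul\<close>.\<close>

definition resolvent_set ::
    "(complex \<Rightarrow> 'a \<Rightarrow> 'a) \<Rightarrow> ('a::ab_group_add \<Rightarrow> 'a) \<Rightarrow> 'a topology \<Rightarrow> complex set" where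
  "resolvent_set smul T X =
     {l. bij_betw (\<lambda>x. smul l x - T x) (topspace X) (topspace X) \<and>
         continuous_map X X (inv_into (topspace X) (\<lambda>x. smul l x - T x))}"

definition spectrum ::
    "(complex \<Rightarrow> 'a \<Rightarrow> 'a) \<Rightarrow> ('a::ab_group_add \<Rightarrow> 'a) \<Rightarrow> 'a topology \<Rightarrow> complex set" where
  "spectrum smul T X = - resolvent_set smul T X"

text \<open>A Dirichlet series is represented by its sequence of coefficients. The indices of a
  Dirichlet series start at 1, so the unused entry at index 0 is required to be 0.\<close>

type_synonym dseries = "nat \<Rightarrow> complex"

definition ds_scale :: "complex \<Rightarrow> dseries \<Rightarrow> dseries" where
  "ds_scale c a = (\<lambda>n. c * a n)"

definition ds_norm :: "nat \<Rightarrow> dseries \<Rightarrow> real" where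
  "ds_norm k a = sqrt (\<Sum>n. (cmod (a n))\<^sup>2 * real n powr (- 2 / real k))"

definition H_plus :: "dseries set" where
  "H_plus = {a. a 0 = 0 \<and>
     (\<forall>k\<ge>1. summable (\<lambda>n. (cmod (a n))\<^sup>2 * real n powr (- 2 / real k)))}"

definition H_plus0 :: "dseries set" where
  "H_plus0 = {a \<in> H_plus. a 1 = 0}"

definition H_plus_top :: "dseries topology" where
  "H_plus_top = seminorm_topology H_plus {ds_norm k | k. k \<ge> 1}"

definition H_plus0_top :: "dseries topology" where
  "H_plus0_top = subtopology H_plus_top H_plus0"

definition ds_diff :: "dseries \<Rightarrow> dseries" where
  "ds_diff a = (\<lambda>n. if n \<ge> 2 then - (a n * complex_of_real (ln (real n))) else 0)"

definition ds_int :: "dseries \<Rightarrow> dseries" where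
  "ds_int a = (\<lambda>n. if n \<ge> 2 then - (a n / complex_of_real (ln (real n))) else 0)"

lemma topspace_seminorm_topology:
  assumes "P \<noteq> {}" and "\<And>p. p \<in> P \<Longrightarrow> p 0 = 0"
  shows "topspace (seminorm_topology X P) = X"
proof -
  obtain p where p: "p \<in> P" using assms(1) by blast
  have "x \<in> \<Union>{{y \<in> X. p (y - x) < e} | x p e. x \<in> X \<and> p \<in> P \<and> 0 < e}" if "x \<in> X" for x
  proof (rule UnionI)
    show "{y \<in> X. p (y - x) < 1} \<in> {{y \<in> X. p (y - x) < e} | x p e. x \<in> X \<and> p \<in> P \<and> 0 < e}"
      using that p zero_less_one[where 'a=real] by blast
    show "x \<in> {y \<in> X. p (y - x) < 1}" using that assms(2)[OF p] by simp
  qed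
  then show ?thesis
    unfolding seminorm_topology_def topology_generated_by_topspace by blast
qed

lemma topspace_H_plus_top [simp]: "topspace H_plus_top = H_plus"
  unfolding H_plus_top_def
  by (rule topspace_seminorm_topology) (auto simp: ds_norm_def)

lemma topspace_H_plus0_top [simp]: "topspace H_plus0_top = H_plus0"
  unfolding H_plus0_top_def by (auto simp: H_plus0_def)

end

theory Submission
  imports Defs "HOL-Real_Asymp.Real_Asymp"
begin

text \<open>Both operators are diagonal: they multiply the \<open>n\<close>-th coefficient by some \<open>m n\<close>. If \<open>l\<close> is one
  of the \<open>m n\<close>, then the \<open>n\<close>-th unit vector is an eigenvector. Otherwise the inverse of \<open>l - T\<close> is
  multiplication by \<open>1 / (l - m n)\<close>, and a multiplier that grows more slowly than every positive
  power of \<open>n\<close> is continuous for the seminorm topology, at the cost of passing from the \<open>k\<close>-th to the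
  \<open>2k\<close>-th seminorm. The multiplier \<open>1 / (l + log n)\<close> is even bounded, and so is
  \<open>1 / (l + 1 / log n)\<close> unless \<open>l = 0\<close>; the remaining one, \<open>log n\<close>, is still slow.\<close>

section \<open>Multipliers of subpolynomial growth\<close>

text \<open>Growth n^o(1). Only large indices count, so default values such as \<open>ln 0\<close>
  or \<open>inverse 0\<close> at finitely many places are harmless.\<close>

definition slow :: "(nat \<Rightarrow> complex) \<Rightarrow> bool" where
  "slow w \<longleftrightarrow> (\<forall>e>0. (\<lambda>n. cmod (w n)) \<in> O(\<lambda>n. real n powr e))"

definition ds_mult :: "(nat \<Rightarrow> complex) \<Rightarrow> dseries \<Rightarrow> dseries" where
  "ds_mult w a = (\<lambda>n. w n * a n)"

text \<open>Treats both spaces at once: \<open>{1..}\<close> gives \<open>H_plus\<close> and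
  \<open>{2..}\<close> gives \<open>H_plus0\<close>.\<close>

definition ds_supp :: "nat set \<Rightarrow> dseries set" where
  "ds_supp I = {a \<in> H_plus. \<forall>n. n \<notin> I \<longrightarrow> a n = 0}"

text \<open>Finitely many exceptional indices are absorbed into the constant, because
  \<open>real n powr e\<close> is at least 1 once \<open>n\<close> is at least 1. At index 0 that
  power is 0, whence the restriction.\<close>

lemma slow_bound:
  assumes "slow w" "0 < e"
  obtains C where "0 < C" "\<And>n. 1 \<le> n \<Longrightarrow> cmod (w n) \<le> C * real n powr e"
proof -
  obtain c where c: "0 < c" "eventually (\<lambda>n. norm (cmod (w n)) \<le> c * norm (real n powr e)) at_top"
    using assms unfolding slow_def by (blast elim: landau_o.bigE)
  then obtain N where N: "\<And>n. n \<ge> N \<Longrightarrow> cmod (w n) \<le> c * real n powr e"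
    by (auto simp: eventually_at_top_linorder)
  define C where "C = c + (\<Sum>n<N. cmod (w n))"
  have "cmod (w n) \<le> C * real n powr e" if "1 \<le> n" for n
  proof (cases "n < N")
    case True
    have "cmod (w n) \<le> (\<Sum>n<N. cmod (w n))"
      using True by (intro member_le_sum) auto
    also have "\<dots> \<le> C" using c(1) by (simp add: C_def)
    also have "\<dots> \<le> C * real n powr e"
    proof -
      have "1 \<le> real n powr e" using that assms(2) by (simp add: ge_one_powr_ge_zero)
      moreover have "0 \<le> C" using c(1) by (simp add: C_def sum_nonneg add_nonneg_nonneg)
      ultimately show ?thesis by (simp add: mult_le_cancel_left1)
    qed
    finally show ?thesis .
  next
    case False
    have "c * real n powr e \<le> C * real n powr e"
      by (intro mult_right_mono) (auto simp: C_def sum_nonneg)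
    with N[of n] False show ?thesis by simp
  qed
  moreover have "0 < C" using c(1) by (simp add: C_def sum_nonneg add_pos_nonneg)
  ultimately show ?thesis using that by blast
qed

lemma slow_const: "slow (\<lambda>_. c)"
  unfolding slow_def by (intro allI impI) real_asymp

lemma slow_diff:
  assumes "slow v" "slow w"
  shows "slow (\<lambda>n. v n - w n)"
  unfolding slow_def
proof (intro allI impI)
  fix e :: real assume "0 < e"
  then have "(\<lambda>n. cmod (v n) + cmod (w n)) \<in> O(\<lambda>n. real n powr e)"
    using assms unfolding slow_def by (intro sum_in_bigo) auto
  moreover have "(\<lambda>n. cmod (v n - w n)) \<in> O(\<lambda>n. cmod (v n) + cmod (w n))"
    by (intro landau_o.big_mono always_eventually)
      (auto intro: norm_triangle_ineq4)
  ultimately show "(\<lambda>n. cmod (v n - w n)) \<in> O(\<lambda>n. real n powr e)"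
    using landau_o.big_trans by blast
qed

text \<open>Convergent sequences are bounded. This covers every inverse \<open>1 / (l - m n)\<close>
  that has a limit.\<close>

lemma slow_convergent:
  assumes "w \<longlonglongrightarrow> c"
  shows "slow w"
  unfolding slow_def
proof (intro allI impI)
  fix e :: real assume "0 < e"
  have "(\<lambda>n. cmod (w n)) \<in> O(\<lambda>_. 1)"
    by (rule bigoI_tendsto[where c = "cmod c"]) (use tendsto_norm[OF assms] in auto)
  moreover have "(\<lambda>_. 1) \<in> O(\<lambda>n. real n powr e)"
    using \<open>0 < e\<close> by real_asymp
  ultimately show "(\<lambda>n. cmod (w n)) \<in> O(\<lambda>n. real n powr e)"
    using landau_o.big_trans by blast
qed

lemma slow_ln: "slow (\<lambda>n. complex_of_real (ln (real n)))"
proof -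
  have "(\<lambda>n. \<bar>ln (real n)\<bar>) \<in> O(\<lambda>n. real n powr e)" if "0 < e" for e
    using that by real_asymp
  then show ?thesis by (simp add: slow_def)
qed

lemma slow_uminus: "slow w \<Longrightarrow> slow (\<lambda>n. - w n)"
  by (simp add: slow_def)

lemma filterlim_complex_ln:
  "filterlim (\<lambda>n. complex_of_real (ln (real n))) at_infinity sequentially"
proof -
  have "filterlim (\<lambda>n. norm (complex_of_real (ln (real n)))) at_top sequentially"
    unfolding norm_of_real by real_asymp
  then show ?thesis by (rule filterlim_norm_at_top_imp_at_infinity)
qed

section \<open>Seminorm estimates\<close>

text \<open>Squaring a bound of order 1/(2k) costs the exponent 1/k, and 1/k - 2/k = -2/(2k) is
  exactly the weight of the seminorm with index \<open>2 * k\<close>.\<close>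

lemma ds_mult_term_le:
  assumes C: "\<And>n. 1 \<le> n \<Longrightarrow> cmod (w n) \<le> C * real n powr (1 / real (2 * k))"
    and k: "1 \<le> k"
  shows "(cmod (ds_mult w a n))\<^sup>2 * real n powr (- 2 / real k)
           \<le> C\<^sup>2 * ((cmod (a n))\<^sup>2 * real n powr (- 2 / real (2 * k)))"
\<comment> \<open>At \<open>n = 0\<close> both sides vanish, since \<open>0 powr x\<close> is
  0.\<close>
proof (cases "n = 0")
  case False
  have "(cmod (w n))\<^sup>2 \<le> (C * real n powr (1 / real (2 * k)))\<^sup>2"
    using C[of n] False by (intro power_mono) auto
  also have "\<dots> = C\<^sup>2 * real n powr (1 / real k)"
    using False by (simp add: power_mult_distrib power2_eq_square flip: powr_add)
  finally have "(cmod (w n))\<^sup>2 * ((cmod (a n))\<^sup>2 * real n powr (- 2 / real k))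
      \<le> C\<^sup>2 * real n powr (1 / real k) * ((cmod (a n))\<^sup>2 * real n powr (- 2 / real k))"
    by (intro mult_right_mono) auto
  also have "\<dots> = C\<^sup>2 * ((cmod (a n))\<^sup>2 * (real n powr (1 / real k) * real n powr (- 2 / real k)))"
    by (simp add: mult_ac)
  also have "real n powr (1 / real k) * real n powr (- 2 / real k) = real n powr (- 2 / real (2 * k))"
    using k by (simp add: field_simps flip: powr_add)
  finally show ?thesis by (simp add: ds_mult_def norm_mult power_mult_distrib mult_ac)
qed simp

lemma H_plus_summable:
  "a \<in> H_plus \<Longrightarrow> 1 \<le> k \<Longrightarrow> summable (\<lambda>n. (cmod (a n))\<^sup>2 * real n powr (- 2 / real k))"
  by (auto simp: H_plus_def)

lemma ds_mult_in_H_plus: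
  assumes "slow w" "a \<in> H_plus"
  shows "ds_mult w a \<in> H_plus"
proof -
  have "summable (\<lambda>n. (cmod (ds_mult w a n))\<^sup>2 * real n powr (- 2 / real k))" if k: "1 \<le> k" for k
  proof -
    obtain C where C: "\<And>n. 1 \<le> n \<Longrightarrow> cmod (w n) \<le> C * real n powr (1 / real (2 * k))"
      using slow_bound[OF assms(1), of "1 / real (2 * k)"] k by auto
    show ?thesis
      by (rule summable_comparison_test'[where N = 0,
            OF summable_mult[OF H_plus_summable[OF assms(2), of "2 * k"]]])
        (use k ds_mult_term_le[OF C k] in auto)
  qed
  then show ?thesis using assms(2) by (auto simp: H_plus_def ds_mult_def)
qed

lemma ds_norm_mult_le:
  assumes "slow w" "1 \<le> k"
  obtains C where "0 < C" "\<And>a. a \<in> H_plus \<Longrightarrow> ds_norm k (ds_mult w a) \<le> C * ds_norm (2 * k) a"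
proof -
  obtain C where C: "0 < C" "\<And>n. 1 \<le> n \<Longrightarrow> cmod (w n) \<le> C * real n powr (1 / real (2 * k))"
    using slow_bound[OF assms(1), of "1 / real (2 * k)"] assms(2) by auto
  have "ds_norm k (ds_mult w a) \<le> C * ds_norm (2 * k) a" if a: "a \<in> H_plus" for a
  proof -
    have s: "summable (\<lambda>n. (cmod (a n))\<^sup>2 * real n powr (- 2 / real (2 * k)))"
      using H_plus_summable[OF a, of "2 * k"] assms(2) by simp
    have "(\<Sum>n. (cmod (ds_mult w a n))\<^sup>2 * real n powr (- 2 / real k))
        \<le> (\<Sum>n. C\<^sup>2 * ((cmod (a n))\<^sup>2 * real n powr (- 2 / real (2 * k))))"
      by (intro suminf_le ds_mult_term_le C assms summable_mult s
            H_plus_summable ds_mult_in_H_plus a)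
    also have "\<dots> = C\<^sup>2 * (\<Sum>n. (cmod (a n))\<^sup>2 * real n powr (- 2 / real (2 * k)))"
      by (rule suminf_mult[OF s])
    finally have "ds_norm k (ds_mult w a)
        \<le> sqrt (C\<^sup>2 * (\<Sum>n. (cmod (a n))\<^sup>2 * real n powr (- 2 / real (2 * k))))"
      unfolding ds_norm_def by (rule real_sqrt_le_mono)
    then show ?thesis using C(1) by (simp add: ds_norm_def real_sqrt_mult)
  qed
  with C(1) that show ?thesis by blast
qed

text \<open>Writes the seminorm as a limit of finite Euclidean norms, with weight n^(-1/k), the
  square root of n^(-2/k), so that the finite Minkowski inequality becomes available.\<close>

lemma ds_norm_L2_limit:
  assumes "a \<in> H_plus" "1 \<le> k"
  shows "(\<lambda>N. L2_set (\<lambda>n. cmod (a n) * real n powr (- 1 / real k)) {..<N}) \<longlonglongrightarrow> ds_norm k a"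
proof -
  have "(cmod (a n) * real n powr (- 1 / real k))\<^sup>2 = (cmod (a n))\<^sup>2 * real n powr (- 2 / real k)" for n
    by (simp add: power_mult_distrib power2_eq_square flip: powr_add)
  then show ?thesis
    unfolding L2_set_def ds_norm_def
    using tendsto_real_sqrt[OF summable_LIMSEQ[OF H_plus_summable[OF assms]]] by simp
qed

text \<open>Minkowski's inequality for the truncations, passed to the limit.\<close>

lemma ds_norm_triangle:
  assumes "a \<in> H_plus" "b \<in> H_plus" "a + b \<in> H_plus" "1 \<le> k"
  shows "ds_norm k (a + b) \<le> ds_norm k a + ds_norm k b"
proof (rule LIMSEQ_le[OF ds_norm_L2_limit[OF assms(3,4)]
        tendsto_add[OF ds_norm_L2_limit[OF assms(1,4)] ds_norm_L2_limit[OF assms(2,4)]]],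
      intro exI allI impI)
  fix N
  have "L2_set (\<lambda>n. cmod ((a + b) n) * real n powr (- 1 / real k)) {..<N}
      \<le> L2_set (\<lambda>n. cmod (a n) * real n powr (- 1 / real k) + cmod (b n) * real n powr (- 1 / real k)) {..<N}"
    by (intro L2_set_mono) (auto simp: norm_triangle_ineq mult_right_mono simp flip: distrib_right)
  also have "\<dots> \<le> L2_set (\<lambda>n. cmod (a n) * real n powr (- 1 / real k)) {..<N}
      + L2_set (\<lambda>n. cmod (b n) * real n powr (- 1 / real k)) {..<N}"
    by (rule L2_set_triangle_ineq)
  finally show "L2_set (\<lambda>n. cmod ((a + b) n) * real n powr (- 1 / real k)) {..<N}
    \<le> L2_set (\<lambda>n. cmod (a n) * real n powr (- 1 / real k)) {..<N}
      + L2_set (\<lambda>n. cmod (b n) * real n powr (- 1 / real k)) {..<N}" .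
qed

text \<open>Termwise comparison by |a - b|^2 \<le> 2|a|^2 + 2|b|^2.\<close>

lemma H_plus_diff:
  assumes "a \<in> H_plus" "b \<in> H_plus"
  shows "a - b \<in> H_plus"
proof -
  have "summable (\<lambda>n. (cmod ((a - b) n))\<^sup>2 * real n powr (- 2 / real k))" if k: "1 \<le> k" for k
  proof (rule summable_comparison_test'[where N = 0])
    show "summable (\<lambda>n. 2 * ((cmod (a n))\<^sup>2 * real n powr (- 2 / real k))
        + 2 * ((cmod (b n))\<^sup>2 * real n powr (- 2 / real k)))"
      by (intro summable_add summable_mult H_plus_summable assms k)
    fix n
    have "(cmod (a n - b n))\<^sup>2 \<le> (cmod (a n) + cmod (b n))\<^sup>2"
      by (intro power_mono norm_triangle_ineq4) auto
    also have "\<dots> \<le> 2 * (cmod (a n))\<^sup>2 + 2 * (cmod (b n))\<^sup>2"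
      using sum_squares_bound[of "cmod (a n)" "cmod (b n)"] by (simp add: power2_sum)
    finally have "(cmod (a n - b n))\<^sup>2 * real n powr (- 2 / real k)
        \<le> (2 * (cmod (a n))\<^sup>2 + 2 * (cmod (b n))\<^sup>2) * real n powr (- 2 / real k)"
      by (rule mult_right_mono) simp
    then show "norm ((cmod ((a - b) n))\<^sup>2 * real n powr (- 2 / real k))
      \<le> 2 * ((cmod (a n))\<^sup>2 * real n powr (- 2 / real k))
        + 2 * ((cmod (b n))\<^sup>2 * real n powr (- 2 / real k))"
      by (simp add: algebra_simps)
  qed
  then show ?thesis using assms by (auto simp: H_plus_def)
qed

section \<open>Continuity of multipliers\<close>

lemma openin_H_plus_ball:
  assumes "x \<in> H_plus" "1 \<le> k" "0 < e"
  shows "openin H_plus_top {y \<in> H_plus. ds_norm k (y - x) < e}"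
  unfolding H_plus_top_def seminorm_topology_def
  by (rule topology_generated_by_Basis) (use assms in blast)

text \<open>It suffices to test preimages of the generating balls. Around each point of such a
  preimage, the estimate of \<open>ds_norm_mult_le\<close> provides a ball of the seminorm with
  index \<open>2 * k\<close>.\<close>

lemma continuous_map_ds_mult:
  assumes "slow w"
  shows "continuous_map H_plus_top H_plus_top (ds_mult w)"
proof -
  let ?B = "{{y \<in> H_plus. p (y - x) < e} | x p e. x \<in> H_plus \<and> p \<in> {ds_norm k | k. k \<ge> 1} \<and> 0 < e}"
  have "continuous_map H_plus_top (topology_generated_by ?B) (ds_mult w)"
  proof (rule continuous_on_generated_topo)
    show "ds_mult w ` topspace H_plus_top \<subseteq> \<Union>?B"
      using topspace_H_plus_top ds_mult_in_H_plus[OF assms]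
      unfolding H_plus_top_def seminorm_topology_def topology_generated_by_topspace by auto
  next
    fix U assume "U \<in> ?B"
    then obtain x k e where x: "x \<in> H_plus" and k: "1 \<le> k" and e: "0 < e"
      and U: "U = {y \<in> H_plus. ds_norm k (y - x) < e}" by blast
    obtain C where C: "0 < C" "\<And>a. a \<in> H_plus \<Longrightarrow> ds_norm k (ds_mult w a) \<le> C * ds_norm (2 * k) a"
      using ds_norm_mult_le[OF assms k] by blast
    show "openin H_plus_top (ds_mult w -` U \<inter> topspace H_plus_top)"
    proof (subst openin_subopen, intro ballI)
      fix y0 assume "y0 \<in> ds_mult w -` U \<inter> topspace H_plus_top"
      then have y0: "y0 \<in> H_plus" "ds_norm k (ds_mult w y0 - x) < e" by (auto simp: U)
      \<comment> \<open>The slack left at \<open>y0\<close>, divided by the constant of the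
        multiplier estimate.\<close>
      define d where "d = (e - ds_norm k (ds_mult w y0 - x)) / C"
      have d: "0 < d" using y0 C(1) by (simp add: d_def)
      let ?V = "{y \<in> H_plus. ds_norm (2 * k) (y - y0) < d}"
      have "ds_norm k (ds_mult w y - x) < e" if y: "y \<in> H_plus" "ds_norm (2 * k) (y - y0) < d" for y
      proof -
        \<comment> \<open>Linearity splits off the increment \<open>y - y0\<close>. Read backwards,
          the equation shows the sum to be a difference of members of \<open>H_plus\<close>, as the
          triangle inequality requires.\<close>
        have eq: "ds_mult w y - x = ds_mult w (y - y0) + (ds_mult w y0 - x)"
          by (auto simp: ds_mult_def fun_eq_iff algebra_simps)
        have "ds_norm k (ds_mult w y - x) \<le> ds_norm k (ds_mult w (y - y0)) + ds_norm k (ds_mult w y0 - x)"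
          unfolding eq
          by (rule ds_norm_triangle)
            (use k in \<open>auto simp flip: eq intro!: H_plus_diff ds_mult_in_H_plus assms x y y0(1)\<close>)
        also have "ds_norm k (ds_mult w (y - y0)) \<le> C * ds_norm (2 * k) (y - y0)"
          by (intro C H_plus_diff y y0)
        also have "C * ds_norm (2 * k) (y - y0) < C * d"
          using y C(1) by simp
        also have "C * d = e - ds_norm k (ds_mult w y0 - x)"
          using C(1) by (simp add: d_def)
        finally show ?thesis by linarith
      qed
      then have "?V \<subseteq> ds_mult w -` U \<inter> topspace H_plus_top"
        using ds_mult_in_H_plus[OF assms] by (auto simp: U)
      moreover have "openin H_plus_top ?V"
        using k d y0 by (intro openin_H_plus_ball) auto
      moreover have "y0 \<in> ?V" using y0 d by (simp add: ds_norm_def)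
      ultimately show "\<exists>T. openin H_plus_top T \<and> y0 \<in> T \<and> T \<subseteq> ds_mult w -` U \<inter> topspace H_plus_top"
        by blast
    qed
  qed
  then show ?thesis by (simp add: H_plus_top_def seminorm_topology_def)
qed

section \<open>Spectra of diagonal operators\<close>

lemma ds_mult_in_ds_supp: "slow w \<Longrightarrow> a \<in> ds_supp I \<Longrightarrow> ds_mult w a \<in> ds_supp I"
  by (simp add: ds_supp_def ds_mult_in_H_plus) (simp add: ds_mult_def)

lemma topspace_ds_supp: "topspace (subtopology H_plus_top (ds_supp I)) = ds_supp I"
  by (auto simp: ds_supp_def)

text \<open>Finite support gives summability; \<open>0 \<notin> I\<close> respects the convention
  that entry 0 vanishes.\<close>

lemma unit_in_ds_supp:
  assumes "n \<in> I" "0 \<notin> I"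
  shows "(\<lambda>i. if i = n then 1 else 0) \<in> ds_supp I"
proof -
  have "summable (\<lambda>i. (cmod (if i = n then 1 else 0))\<^sup>2 * real i powr (- 2 / real k))" for k
    by (rule summable_finite[of "{n}"]) auto
  moreover have "n \<noteq> 0" using assms by (cases "n = 0") simp_all
  ultimately show ?thesis using assms by (auto simp: ds_supp_def H_plus_def)
qed

text \<open>Slowness of \<open>m\<close> keeps \<open>l - T\<close> inside the space; slowness of
  the inverse multiplier does the same for the inverse and also makes it continuous.\<close>

lemma spectrum_diagonal:
  assumes I: "0 \<notin> I"
    and T: "\<And>a. a \<in> ds_supp I \<Longrightarrow> T a = ds_mult m a"
    and m: "slow m"
    and inv: "\<And>l. l \<notin> m ` I \<Longrightarrow> slow (\<lambda>n. inverse (l - m n))"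
  shows "spectrum ds_scale T (subtopology H_plus_top (ds_supp I)) = m ` I"
proof -
  let ?X = "ds_supp I"
  let ?f = "\<lambda>l x. ds_scale l x - T x"
  have f: "?f l x = ds_mult (\<lambda>n. l - m n) x" if "x \<in> ?X" for l x
    by (auto simp: T[OF that] ds_scale_def ds_mult_def fun_eq_iff algebra_simps)
  have "l \<notin> resolvent_set ds_scale T (subtopology H_plus_top ?X)" if "l \<in> m ` I" for l
  proof -
    obtain n where n: "n \<in> I" "l = m n" using \<open>l \<in> m ` I\<close> by blast
    let ?u = "(\<lambda>i. if i = n then 1 else 0) :: dseries"
    have u: "?u \<in> ?X" "0 \<in> ?X"
      using unit_in_ds_supp[OF n(1) I] by (auto simp: ds_supp_def H_plus_def)
    \<comment> \<open>The factor \<open>l - m i\<close> is 0 at \<open>i = n\<close>, the only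
      nonzero coordinate of \<open>?u\<close>, so \<open>?u\<close> lies in the kernel.\<close>
    have "?f l ?u = ?f l 0"
      unfolding f[OF u(1)] f[OF u(2)] by (auto simp: ds_mult_def n(2))
    moreover have "?u \<noteq> 0" by (auto simp: fun_eq_iff)
    ultimately have "\<not> inj_on (?f l) ?X" using u by (auto simp: inj_on_def)
    then show ?thesis
      unfolding resolvent_set_def topspace_ds_supp bij_betw_def by blast
  qed
  moreover have "l \<in> resolvent_set ds_scale T (subtopology H_plus_top ?X)" if l: "l \<notin> m ` I" for l
  proof -
    let ?g = "ds_mult (\<lambda>n. inverse (l - m n))"
    have ne: "l - m n \<noteq> 0" if "n \<in> I" for n using l that by auto
    have g: "?g x \<in> ?X" if "x \<in> ?X" for x
      using ds_mult_in_ds_supp[OF inv[OF l] that] .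
    have fX: "?f l x \<in> ?X" if "x \<in> ?X" for x
      unfolding f[OF that] by (intro ds_mult_in_ds_supp slow_diff slow_const m that)
    have fg: "?f l (?g x) = x" and gf: "?g (?f l x) = x" if "x \<in> ?X" for x
    proof -
      \<comment> \<open>Outside \<open>I\<close> the factor may be 0, but there \<open>x n\<close>
        is 0 as well.\<close>
      have c: "(l - m n) * (inverse (l - m n) * x n) = x n"
              "inverse (l - m n) * ((l - m n) * x n) = x n" for n
      proof -
        have "x n = 0" if "n \<notin> I" using that \<open>x \<in> ?X\<close> by (auto simp: ds_supp_def)
        then show "(l - m n) * (inverse (l - m n) * x n) = x n"
          "inverse (l - m n) * ((l - m n) * x n) = x n"
          using ne[of n] by (cases "n \<in> I"; simp)+
      qed
      have "?f l (?g x) = ds_mult (\<lambda>n. l - m n) (?g x)" by (rule f[OF g[OF that]])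
      then show "?f l (?g x) = x" by (simp only: ds_mult_def c)
      show "?g (?f l x) = x" by (simp only: f[OF that]) (simp only: ds_mult_def c)
    qed
    have bij: "bij_betw (?f l) ?X ?X"
      by (intro bij_betw_byWitness[where f' = ?g] ballI image_subsetI fg gf g fX)
    have "continuous_map (subtopology H_plus_top ?X) (subtopology H_plus_top ?X) ?g"
      using g by (auto simp: continuous_map_in_subtopology
          intro!: continuous_map_from_subtopology continuous_map_ds_mult inv l)
    \<comment> \<open>The resolvent set is phrased with \<open>inv_into\<close>, so continuity is
      transferred from \<open>?g\<close>, which agrees with it on the space.\<close>
    moreover have "?g x = inv_into ?X (?f l) x" if "x \<in> ?X" for x
      using bij_betw_inv_into_left[OF bij g[OF that]] unfolding fg[OF that] by simp
    ultimately have "continuous_map (subtopology H_plus_top ?X) (subtopology H_plus_top ?X)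
        (inv_into ?X (?f l))"
      by (rule continuous_map_eq) (simp only: topspace_ds_supp)
    with bij show ?thesis unfolding resolvent_set_def topspace_ds_supp by blast
  qed
  ultimately show ?thesis by (auto simp: spectrum_def)
qed

section \<open>Differentiation and integration\<close>

lemma spectrum_ds_diff:
  assumes "0 \<notin> I"
  shows "spectrum ds_scale ds_diff (subtopology H_plus_top (ds_supp I))
           = (\<lambda>n. - complex_of_real (ln (real n))) ` I"
proof (rule spectrum_diagonal[OF assms])
  fix a assume "a \<in> ds_supp I"
  show "ds_diff a = ds_mult (\<lambda>n. - complex_of_real (ln (real n))) a"
  proof
    fix n :: nat
    consider "n = 0" | "n = 1" | "n \<ge> 2" by linarith
    then show "ds_diff a n = ds_mult (\<lambda>n. - complex_of_real (ln (real n))) a n"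
      by cases (auto simp: ds_diff_def ds_mult_def)
  qed
next
  show "slow (\<lambda>n. - complex_of_real (ln (real n)))" by (intro slow_uminus slow_ln)
next
  fix l :: complex
  \<comment> \<open>The denominator l + log n tends to infinity, so its inverse tends to 0.\<close>
  show "slow (\<lambda>n. inverse (l - - complex_of_real (ln (real n))))"
    unfolding diff_minus_eq_add
    by (intro slow_convergent[where c = 0] filterlim_compose[OF tendsto_inverse_0]
        tendsto_add_filterlim_at_infinity[OF tendsto_const] filterlim_complex_ln)
qed

text \<open>Although 0 is the limit of the eigenvalues, it lies in the resolvent set, because the
  inverse multiplier log n is slow; the spectrum is not closed.\<close>

lemma spectrum_ds_int:
  "spectrum ds_scale ds_int (subtopology H_plus_top (ds_supp {2..}))
     = (\<lambda>n. - (1 / complex_of_real (ln (real n)))) ` {2..}"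
proof (rule spectrum_diagonal)
  have lim: "(\<lambda>n. 1 / complex_of_real (ln (real n))) \<longlonglongrightarrow> 0"
    using filterlim_compose[OF tendsto_inverse_0 filterlim_complex_ln] by (simp add: inverse_eq_divide)
  then show "slow (\<lambda>n. - (1 / complex_of_real (ln (real n))))"
    by (intro slow_uminus slow_convergent)
  fix l :: complex
  show "slow (\<lambda>n. inverse (l - - (1 / complex_of_real (ln (real n)))))"
  proof (cases "l = 0")
    case True
    then show ?thesis using slow_ln by simp
  next
    case False
    have "(\<lambda>n. inverse (l + 1 / complex_of_real (ln (real n)))) \<longlonglongrightarrow> inverse (l + 0)"
      using False by (intro tendsto_intros lim) simp
    then show ?thesis by (simp add: slow_convergent)
  qed
qed (auto simp: ds_int_def ds_mult_def ds_supp_def fun_eq_iff)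

lemma ds_supp_ge_1: "ds_supp {1..} = H_plus"
proof -
  have "n \<notin> {1..} \<longleftrightarrow> n = 0" for n :: nat by auto
  then show ?thesis by (auto simp: ds_supp_def H_plus_def)
qed

lemma ds_supp_ge_2: "ds_supp {2..} = H_plus0"
proof -
  have "n \<notin> {2..} \<longleftrightarrow> n = 0 \<or> n = 1" for n :: nat by auto
  then show ?thesis by (auto simp: ds_supp_def H_plus_def H_plus0_def)
qed

theorem proposition6p2:
  "spectrum ds_scale ds_diff H_plus0_top =
           {- complex_of_real (ln (real n)) | n. n \<ge> 2} \<and>
   spectrum ds_scale ds_diff H_plus_top =
           {0} \<union> {- complex_of_real (ln (real n)) | n. n \<ge> 2} \<and>
   spectrum ds_scale ds_int H_plus0_top =
           {- (1 / complex_of_real (ln (real n))) | n. n \<ge> 2}"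
proof -
  have top: "subtopology H_plus_top (ds_supp {1..}) = H_plus_top"
    unfolding ds_supp_ge_1 by (metis subtopology_topspace topspace_H_plus_top)
  \<comment> \<open>The index 1, present only in the full space, contributes the eigenvalue -log 1 =
    0.\<close>
  have "{1::nat..} = insert 1 {2..}" by auto
  then have "(\<lambda>n. - complex_of_real (ln (real n))) ` {1..}
      = {0} \<union> {- complex_of_real (ln (real n)) | n. n \<ge> 2}"
    by auto
  then have "spectrum ds_scale ds_diff H_plus_top
      = {0} \<union> {- complex_of_real (ln (real n)) | n. n \<ge> 2}"
    using spectrum_ds_diff[of "{1..}"] unfolding top by simp
  then show ?thesis
    using spectrum_ds_diff[of "{2..}"] spectrum_ds_int
    by (auto simp: H_plus0_top_def ds_supp_ge_2)
qed

end
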